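(* Let $I$ be a set and $F:[0,+\infty]^I\to[0,+\infty]$ a function. The following statements are equivalent: (1) $F:\mathsf{P}_+^I\to\mathsf{P}_+$ is preserving; (2) $F$ is an extended quasi-pseudometric aggregation function on products; (3) $F$ is an extended quasi-pseudometric aggregation function on sets. Consequently, $\mathscr{P}(\mathsf{P}_+^I,\mathsf{P}_+)=\mathsf{EQPMAP}^I=\mathsf{EQPMAS}^I$, where $\mathscr{P}(\mathsf{P}_+^I,\mathsf{P}_+)$ is the family of preserving functions from $\mathsf{P}_+^I$ to $\mathsf{P}_+$, and $\mathsf{EQPMAP}^I$ (resp. $\mathsf{EQPMAS}^I$) is the family of extended quasi-pseudometric aggregation functions on products (resp. on sets) defined on $[0,+\infty]^I$.
   Context: A commutative integral quantale $(\mathscr{V},\preceq,\ast)$ is a complete lattice $(\mathscr{V},\preceq)$ with an associative commutative binary operation $\ast$ that distributes over arbitrary suprema and has a unit $1_\mathscr{V}$ which is the top element. $\mathsf{P}_+=([0,+\infty],\leq^{\mathrm{op}},+)$ is the Lawvere quantale, where $x\leq^{\mathrm{op}}y$ iff $y\leq x$; its unit is $0$. $\mathsf{P}_+^I$ is $[0,+\infty]^I$ with componentwise order $\leq^{\mathrm{op}}$ and componentwise addition; its unit is $(0)_{i\in I}$. A $\mathscr{V}$-category is a pair $(X,a)$ with $X$ a nonempty set and $a:X\times X\to\mathscr{V}$ such that $1_\mathscr{V}\preceq a(x,x)$ and $a(x,z)\ast a(z,y)\preceq a(x,y)$ for all $x,y,z\in X$. A map $F:\mathscr{V}\to\mathscr{W}$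 between quantales is *preserving* if $(X,F\circ a)$ is a $\mathscr{W}$-category for every $\mathscr{V}$-category $(X,a)$. An extended quasi-pseudometric on a nonempty set $X$ is a map $d:X\times X\to[0,+\infty]$ with $d(x,x)=0$ and $d(x,y)\leq d(x,z)+d(z,y)$ for all $x,y,z\in X$. $F:[0,+\infty]^I\to[0,+\infty]$ is an *extended quasi-pseudometric aggregation function on products* if for every family $\{(X_i,d_i):i\in I\}$ of extended quasi-pseudometric spaces, $(x,y)\mapsto F((d_i(x_i,y_i))_{i\in I})$ is an extended quasi-pseudometric on $\prod_{i\in I}X_i$. It is an *extended quasi-pseudometric aggregation function on sets* if for every nonempty set $X$ and every family $\{d_i:i\in I\}$ of extended quasi-pseudometrics on $X$, $(x,y)\mapsto F((d_i(x,y))_{i\in I})$ is an extended quasi-pseudometric on $X$. *)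

theory Defs
  imports
    "HOL-Algebra.Complete_Lattice"
    "HOL-Library.Extended_Nonnegative_Real"
    "HOL-Library.Infinite_Typeclass"
begin

section \<open>Quantales\<close>

record 'v quantale = "'v gorder" +
  tensor :: "['v, 'v] \<Rightarrow> 'v" (infixl \<open>\<otimes>\<index>\<close> 70)
  qunit :: 'v (\<open>\<one>\<index>\<close>)

locale commutative_integral_quantale = complete_lattice V
  for V :: "('v, 'm) quantale_scheme" (structure) +
  assumes tensor_closed: "\<lbrakk>x \<in> carrier V; y \<in> carrier V\<rbrakk> \<Longrightarrow> x \<otimes> y \<in> carrier V"
    and tensor_assoc:
      "\<lbrakk>x \<in> carrier V; y \<in> carrier V; z \<in> carrier V\<rbrakk> \<Longrightarrow> (x \<otimes> y) \<otimes> z = x \<otimes> (y \<otimes> z)"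
    and tensor_commute: "\<lbrakk>x \<in> carrier V; y \<in> carrier V\<rbrakk> \<Longrightarrow> x \<otimes> y = y \<otimes> x"
    and tensor_sup: "\<lbrakk>x \<in> carrier V; A \<subseteq> carrier V\<rbrakk> \<Longrightarrow> x \<otimes> \<Squnion>A = \<Squnion>((\<lambda>a. x \<otimes> a) ` A)"
    and unit_closed: "\<one> \<in> carrier V"
    and unit_tensor: "x \<in> carrier V \<Longrightarrow> \<one> \<otimes> x = x"
    and unit_top: "x \<in> carrier V \<Longrightarrow> x \<sqsubseteq> \<one>"

definition lawvere_quantale :: "ennreal quantale" (\<open>P\<^sub>+\<close>) where
  "P\<^sub>+ = \<lparr>carrier = UNIV, eq = (=), le = (\<lambda>x y. y \<le> x), tensor = (+), qunit = 0\<rparr>"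

text \<open>A point of \<open>[0,\<infinity>]\<^sup>I\<close> is a function that is \<open>undefined\<close> outside \<open>I\<close>, so that
  equality of points is equality of their \<open>I\<close>-indexed components; \<open>I\<close> may be empty.\<close>

definition lawvere_power :: "'i set \<Rightarrow> ('i \<Rightarrow> ennreal) quantale" where
  "lawvere_power I =
    \<lparr>carrier = I \<rightarrow>\<^sub>E UNIV, eq = (=),
     le = (\<lambda>x y. \<forall>i\<in>I. y i \<le> x i),
     tensor = (\<lambda>x y. \<lambda>i\<in>I. x i + y i),
     qunit = (\<lambda>i\<in>I. 0)\<rparr>"


section \<open>Categories enriched in a quantale and preserving functions\<close>

definition V_category ::
    "('v, 'm) quantale_scheme \<Rightarrow> 'x set \<Rightarrow> ('x \<Rightarrow> 'x \<Rightarrow> 'v) \<Rightarrow> bool" where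
  "V_category V X a \<longleftrightarrow>
    X \<noteq> {} \<and>
    (\<forall>x\<in>X. \<forall>y\<in>X. a x y \<in> carrier V) \<and>
    (\<forall>x\<in>X. \<one>\<^bsub>V\<^esub> \<sqsubseteq>\<^bsub>V\<^esub> a x x) \<and>
    (\<forall>x\<in>X. \<forall>y\<in>X. \<forall>z\<in>X. a x z \<otimes>\<^bsub>V\<^esub> a z y \<sqsubseteq>\<^bsub>V\<^esub> a x y)"

text \<open>HOL cannot quantify over all sets of all types inside a formula.  The
  notions below that refer to every set \<open>X\<close> (or every family of sets) therefore take
  a type argument \<open>'x\<close>, the universe from which these sets are drawn.\<close>

definition preserving ::
    "'x itself \<Rightarrow> ('v, 'm) quantale_scheme \<Rightarrow> ('w, 'n) quantale_scheme \<Rightarrow> ('v \<Rightarrow> 'w) \<Rightarrow> bool" where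
  "preserving TYPE('x) V W F \<longleftrightarrow>
    F \<in> carrier V \<rightarrow> carrier W \<and>
    (\<forall>(X :: 'x set) a. V_category V X a \<longrightarrow> V_category W X (\<lambda>x y. F (a x y)))"

definition preserving_functions ::
    "'x itself \<Rightarrow> ('v, 'm) quantale_scheme \<Rightarrow> ('w, 'n) quantale_scheme \<Rightarrow> ('v \<Rightarrow> 'w) set" where
  "preserving_functions TYPE('x) V W =
    {F \<in> carrier V \<rightarrow>\<^sub>E carrier W. preserving TYPE('x) V W F}"


section \<open>Extended quasi-pseudometrics and their aggregation\<close>

definition ext_quasi_pseudometric :: "'x set \<Rightarrow> ('x \<Rightarrow> 'x \<Rightarrow> ennreal) \<Rightarrow> bool" where
  "ext_quasi_pseudometric X d \<longleftrightarrow>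
    X \<noteq> {} \<and>
    (\<forall>x\<in>X. d x x = 0) \<and>
    (\<forall>x\<in>X. \<forall>y\<in>X. \<forall>z\<in>X. d x y \<le> d x z + d z y)"

definition eqpm_aggregation_on_products ::
    "'x itself \<Rightarrow> 'i set \<Rightarrow> (('i \<Rightarrow> ennreal) \<Rightarrow> ennreal) \<Rightarrow> bool" where
  "eqpm_aggregation_on_products TYPE('x) I F \<longleftrightarrow>
    (\<forall>(X :: 'i \<Rightarrow> 'x set) d.
      (\<forall>i\<in>I. ext_quasi_pseudometric (X i) (d i)) \<longrightarrow>
      ext_quasi_pseudometric (\<Pi>\<^sub>E i\<in>I. X i) (\<lambda>x y. F (\<lambda>i\<in>I. d i (x i) (y i))))"

definition eqpm_aggregation_on_sets ::
    "'x itself \<Rightarrow> 'i set \<Rightarrow> (('i \<Rightarrow> ennreal) \<Rightarrow> ennreal) \<Rightarrow> bool" where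
  "eqpm_aggregation_on_sets TYPE('x) I F \<longleftrightarrow>
    (\<forall>(X :: 'x set) d.
      X \<noteq> {} \<longrightarrow>
      (\<forall>i\<in>I. ext_quasi_pseudometric X (d i)) \<longrightarrow>
      ext_quasi_pseudometric X (\<lambda>x y. F (\<lambda>i\<in>I. d i x y)))"

definition EQPMAP :: "'x itself \<Rightarrow> 'i set \<Rightarrow> (('i \<Rightarrow> ennreal) \<Rightarrow> ennreal) set" where
  "EQPMAP TYPE('x) I =
    {F \<in> (I \<rightarrow>\<^sub>E UNIV) \<rightarrow>\<^sub>E UNIV. eqpm_aggregation_on_products TYPE('x) I F}"

definition EQPMAS :: "'x itself \<Rightarrow> 'i set \<Rightarrow> (('i \<Rightarrow> ennreal) \<Rightarrow> ennreal) set" where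
  "EQPMAS TYPE('x) I =
    {F \<in> (I \<rightarrow>\<^sub>E UNIV) \<rightarrow>\<^sub>E UNIV. eqpm_aggregation_on_sets TYPE('x) I F}"


section \<open>The quantales above are commutative and integral\<close>

lemma ennreal_add_INF: "(x::ennreal) + Inf A = Inf ((\<lambda>a. x + a) ` A)"
proof (cases "A = {}")
  case True
  then show ?thesis by simp
next
  case False
  have "continuous (at_right (Inf A)) (\<lambda>a. x + a)"
    by (intro continuous_intros)
  then show ?thesis
    using continuous_at_Inf_mono[of "\<lambda>a. x + a" A] False by (simp add: mono_def add_left_mono)
qed

lemma lawvere_power_lub:
  assumes A: "A \<subseteq> carrier (lawvere_power I)"
  shows "least (lawvere_power I) (\<lambda>i\<in>I. INF a\<in>A. a i) (Upper (lawvere_power I) A)"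
  unfolding least_def Upper_def
proof (intro conjI ballI)
  have le: "(INF a\<in>A. a i) \<le> x i" if "x \<in> A" for x i
    using that by (rule INF_lower)
  show "(\<lambda>i\<in>I. INF a\<in>A. a i) \<in>
      {u. \<forall>x. x \<in> A \<inter> carrier (lawvere_power I) \<longrightarrow> x \<sqsubseteq>\<^bsub>lawvere_power I\<^esub> u}
        \<inter> carrier (lawvere_power I)"
    using le by (simp add: lawvere_power_def)
next
  fix u assume "u \<in> {u. \<forall>x. x \<in> A \<inter> carrier (lawvere_power I) \<longrightarrow>
      x \<sqsubseteq>\<^bsub>lawvere_power I\<^esub> u} \<inter> carrier (lawvere_power I)"
  with A have "\<forall>a\<in>A. \<forall>i\<in>I. u i \<le> a i"
    unfolding lawvere_power_def by (simp add: subset_eq)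
  then show "(\<lambda>i\<in>I. INF a\<in>A. a i) \<sqsubseteq>\<^bsub>lawvere_power I\<^esub> u"
    by (simp add: lawvere_power_def le_INF_iff)
qed simp

lemma lawvere_power_glb:
  assumes A: "A \<subseteq> carrier (lawvere_power I)"
  shows "greatest (lawvere_power I) (\<lambda>i\<in>I. SUP a\<in>A. a i) (Lower (lawvere_power I) A)"
  unfolding greatest_def Lower_def
proof (intro conjI ballI)
  have le: "x i \<le> (SUP a\<in>A. a i)" if "x \<in> A" for x i
    using that by (rule SUP_upper)
  show "(\<lambda>i\<in>I. SUP a\<in>A. a i) \<in>
      {l. \<forall>x. x \<in> A \<inter> carrier (lawvere_power I) \<longrightarrow> l \<sqsubseteq>\<^bsub>lawvere_power I\<^esub> x}
        \<inter> carrier (lawvere_power I)"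
    using le by (simp add: lawvere_power_def)
next
  fix l assume "l \<in> {l. \<forall>x. x \<in> A \<inter> carrier (lawvere_power I) \<longrightarrow>
      l \<sqsubseteq>\<^bsub>lawvere_power I\<^esub> x} \<inter> carrier (lawvere_power I)"
  with A have "\<forall>a\<in>A. \<forall>i\<in>I. a i \<le> l i"
    unfolding lawvere_power_def by (simp add: subset_eq)
  then show "l \<sqsubseteq>\<^bsub>lawvere_power I\<^esub> (\<lambda>i\<in>I. SUP a\<in>A. a i)"
    by (simp add: lawvere_power_def SUP_le_iff)
qed simp

lemma complete_lattice_lawvere_power: "complete_lattice (lawvere_power I)"
proof (rule partial_order.complete_latticeI)
  show "partial_order (lawvere_power I)"
  proof
    fix x y
    assume "x \<sqsubseteq>\<^bsub>lawvere_power I\<^esub> y" "y \<sqsubseteq>\<^bsub>lawvere_power I\<^esub> x"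
      and xy: "x \<in> carrier (lawvere_power I)" "y \<in> carrier (lawvere_power I)"
    then have "x i = y i" if "i \<in> I" for i
      using that by (simp add: lawvere_power_def order_antisym)
    with xy have "x = y"
      by (intro PiE_ext[of x I "\<lambda>_. UNIV" y]) (simp_all add: lawvere_power_def)
    then show "x .=\<^bsub>lawvere_power I\<^esub> y" by (simp add: lawvere_power_def)
  next
    fix x y z
    assume "x \<sqsubseteq>\<^bsub>lawvere_power I\<^esub> y" "y \<sqsubseteq>\<^bsub>lawvere_power I\<^esub> z"
    then show "x \<sqsubseteq>\<^bsub>lawvere_power I\<^esub> z"
      by (simp add: lawvere_power_def) (meson order_trans)
  qed (simp_all add: lawvere_power_def)
next
  fix A assume "A \<subseteq> carrier (lawvere_power I)"
  then show "\<exists>s. least (lawvere_power I) s (Upper (lawvere_power I) A)"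
    by (intro exI[of _ "\<lambda>i\<in>I. INF a\<in>A. a i"] lawvere_power_lub)
next
  fix A assume "A \<subseteq> carrier (lawvere_power I)"
  then show "\<exists>s. greatest (lawvere_power I) s (Lower (lawvere_power I) A)"
    by (intro exI[of _ "\<lambda>i\<in>I. SUP a\<in>A. a i"] lawvere_power_glb)
qed

lemma lawvere_power_sup:
  assumes "A \<subseteq> carrier (lawvere_power I)"
  shows "\<Squnion>\<^bsub>lawvere_power I\<^esub>A = (\<lambda>i\<in>I. INF a\<in>A. a i)"
proof -
  interpret complete_lattice "lawvere_power I" by (rule complete_lattice_lawvere_power)
  show ?thesis
    using lawvere_power_lub[OF assms] sup_lub[OF assms] least_unique by blast
qed

lemma commutative_integral_quantale_lawvere_power:
  "commutative_integral_quantale (lawvere_power I)"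
proof -
  interpret complete_lattice "lawvere_power I" by (rule complete_lattice_lawvere_power)
  show ?thesis
  proof
    fix x A assume x: "x \<in> carrier (lawvere_power I)" and A: "A \<subseteq> carrier (lawvere_power I)"
    have B: "(\<lambda>a. x \<otimes>\<^bsub>lawvere_power I\<^esub> a) ` A \<subseteq> carrier (lawvere_power I)"
      by (auto simp: lawvere_power_def)
    show "x \<otimes>\<^bsub>lawvere_power I\<^esub> \<Squnion>\<^bsub>lawvere_power I\<^esub>A =
        \<Squnion>\<^bsub>lawvere_power I\<^esub>((\<lambda>a. x \<otimes>\<^bsub>lawvere_power I\<^esub> a) ` A)"
      unfolding lawvere_power_sup[OF A] lawvere_power_sup[OF B]
      by (auto simp: lawvere_power_def fun_eq_iff ennreal_add_INF image_image)
  next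
    fix x assume x: "x \<in> carrier (lawvere_power I)"
    then have "x i = undefined" if "i \<notin> I" for i
      using that by (auto simp: lawvere_power_def intro: PiE_arb)
    then show "\<one>\<^bsub>lawvere_power I\<^esub> \<otimes>\<^bsub>lawvere_power I\<^esub> x = x"
      by (simp add: lawvere_power_def fun_eq_iff restrict_def)
  qed (simp_all add: lawvere_power_def restrict_def fun_eq_iff ac_simps
      PiE_iff extensional_def)
qed

lemma complete_lattice_lawvere: "complete_lattice P\<^sub>+"
proof (rule partial_order.complete_latticeI)
  show "partial_order P\<^sub>+"
    by standard (auto simp: lawvere_quantale_def)
next
  fix A assume "A \<subseteq> carrier P\<^sub>+"
  have "least P\<^sub>+ (Inf A) (Upper P\<^sub>+ A)"
    by (auto simp: least_def Upper_def lawvere_quantale_def intro: Inf_lower Inf_greatest)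
  then show "\<exists>s. least P\<^sub>+ s (Upper P\<^sub>+ A)" ..
next
  fix A assume "A \<subseteq> carrier P\<^sub>+"
  have "greatest P\<^sub>+ (Sup A) (Lower P\<^sub>+ A)"
    by (auto simp: greatest_def Lower_def lawvere_quantale_def intro: Sup_upper Sup_least)
  then show "\<exists>s. greatest P\<^sub>+ s (Lower P\<^sub>+ A)" ..
qed

lemma commutative_integral_quantale_lawvere: "commutative_integral_quantale P\<^sub>+"
proof -
  interpret complete_lattice "P\<^sub>+" by (rule complete_lattice_lawvere)
  have sup_eq: "\<Squnion>\<^bsub>P\<^sub>+\<^esub>A = Inf A" for A
  proof -
    have A: "A \<subseteq> carrier P\<^sub>+" by (simp add: lawvere_quantale_def)
    have "least P\<^sub>+ (Inf A) (Upper P\<^sub>+ A)"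
      by (auto simp: least_def Upper_def lawvere_quantale_def intro: Inf_lower Inf_greatest)
    then show ?thesis using sup_lub[OF A] least_unique by blast
  qed
  show ?thesis
  proof
    fix x A
    show "x \<otimes>\<^bsub>P\<^sub>+\<^esub> \<Squnion>\<^bsub>P\<^sub>+\<^esub>A = \<Squnion>\<^bsub>P\<^sub>+\<^esub>((\<lambda>a. x \<otimes>\<^bsub>P\<^sub>+\<^esub> a) ` A)"
      by (simp add: sup_eq) (simp add: lawvere_quantale_def ennreal_add_INF)
  qed (auto simp: lawvere_quantale_def ac_simps)
qed

end

theory Submission
  imports Defs
begin

text \<open>Each of the three notions is equivalent to the same condition on \<open>F\<close>: it vanishes at the
  origin and sends asymmetric triangle triplets, i.e. triples with \<open>a \<le> b + c\<close> componentwise, to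
  asymmetric triangle triplets.  Every such triplet consists of distances in a three-point space
  whose remaining distances are all infinite, and this forces the condition on \<open>F\<close>.\<close>

definition preserves_triangle_triplets :: "'i set \<Rightarrow> (('i \<Rightarrow> ennreal) \<Rightarrow> ennreal) \<Rightarrow> bool" where
  "preserves_triangle_triplets I F \<longleftrightarrow>
    F (\<lambda>i\<in>I. 0) = 0 \<and>
    (\<forall>a\<in>I \<rightarrow>\<^sub>E UNIV. \<forall>b\<in>I \<rightarrow>\<^sub>E UNIV. \<forall>c\<in>I \<rightarrow>\<^sub>E UNIV.
      (\<forall>i\<in>I. a i \<le> b i + c i) \<longrightarrow> F a \<le> F b + F c)"

text \<open>Restricting the arguments to \<open>I\<close> discharges the three membership
  conditions, so the rule fits the restricted families of distances that aggregation feeds to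
  \<open>F\<close>.\<close>

lemma preserves_triangle_tripletsD:
  assumes "preserves_triangle_triplets I F" and "\<And>i. i \<in> I \<Longrightarrow> a i \<le> b i + c i"
  shows "F (\<lambda>i\<in>I. a i) \<le> F (\<lambda>i\<in>I. b i) + F (\<lambda>i\<in>I. c i)"
  using assms unfolding preserves_triangle_triplets_def by simp

text \<open>Provides the points of the test space; this is where the sort \<open>infinite\<close> of
  the universe enters.\<close>

lemma ex_three_distinct: "\<exists>p q r :: 'x::infinite. p \<noteq> q \<and> p \<noteq> r \<and> q \<noteq> r"
proof -
  obtain A :: "'x set" where "card A = 3"
    using infinite_arbitrarily_large[OF infinite_UNIV] by blast
  then show ?thesis
    by (auto simp: card_3_iff)
qed

definition three_point_dist ::
    "'x \<Rightarrow> 'x \<Rightarrow> 'x \<Rightarrow> ennreal \<Rightarrow> ennreal \<Rightarrow> ennreal \<Rightarrow> 'x \<Rightarrow> 'x \<Rightarrow> ennreal" where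
  "three_point_dist p q r a b c x y =
    (if x = y then 0 else if x = p \<and> y = q then a else if x = p \<and> y = r then b
     else if x = r \<and> y = q then c else \<infinity>)"

text \<open>Between distinct points only the steps from \<open>p\<close> to \<open>q\<close>, from
  \<open>p\<close> to \<open>r\<close> and from \<open>r\<close> to \<open>q\<close> can be finite.
  The only two of them that compose are \<open>p\<close> to \<open>r\<close> to \<open>q\<close>, so
  the hypothesis is the one triangle inequality that is not immediate.\<close>

lemma ext_quasi_pseudometric_three_point_dist:
  assumes "p \<noteq> q" "p \<noteq> r" "q \<noteq> r" "a \<le> b + c"
  shows "ext_quasi_pseudometric {p, q, r} (three_point_dist p q r a b c)"
  using assms by (auto simp: ext_quasi_pseudometric_def three_point_dist_def)

lemma eqpm_aggregation_on_sets_iff: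
  fixes I :: "'i set"
  shows "eqpm_aggregation_on_sets TYPE('x::infinite) I F \<longleftrightarrow> preserves_triangle_triplets I F"
proof
  assume F: "preserves_triangle_triplets I F"
  show "eqpm_aggregation_on_sets TYPE('x) I F"
    unfolding eqpm_aggregation_on_sets_def
  proof (intro allI impI)
    fix X :: "'x set" and d
    assume "X \<noteq> {}" and d: "\<forall>i\<in>I. ext_quasi_pseudometric X (d i)"
    moreover have "F (\<lambda>i\<in>I. d i x x) = 0" if "x \<in> X" for x
    proof -
      have "(\<lambda>i\<in>I. d i x x) = (\<lambda>i\<in>I. 0)"
        using d that by (auto simp: ext_quasi_pseudometric_def)
      then show ?thesis using F by (simp add: preserves_triangle_triplets_def)
    qed
    moreover have "F (\<lambda>i\<in>I. d i x y) \<le> F (\<lambda>i\<in>I. d i x z) + F (\<lambda>i\<in>I. d i z y)"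
      if "x \<in> X" "y \<in> X" "z \<in> X" for x y z
      using d that by (intro preserves_triangle_tripletsD[OF F]) (simp add: ext_quasi_pseudometric_def)
    ultimately show "ext_quasi_pseudometric X (\<lambda>x y. F (\<lambda>i\<in>I. d i x y))"
      by (simp add: ext_quasi_pseudometric_def)
  qed
next
  assume F: "eqpm_aggregation_on_sets TYPE('x) I F"
  obtain p q r :: 'x where pqr: "p \<noteq> q" "p \<noteq> r" "q \<noteq> r"
    using ex_three_distinct by blast
  \<comment> \<open>All indices share the carrier and only the distances vary with \<open>i\<close>,
    so a single space tests a whole triplet of vectors.\<close>
  have key: "ext_quasi_pseudometric {p, q, r}
      (\<lambda>x y. F (\<lambda>i\<in>I. three_point_dist p q r (a i) (b i) (c i) x y))"
    if "\<forall>i\<in>I. a i \<le> b i + c i" for a b c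
    using F that pqr unfolding eqpm_aggregation_on_sets_def
    by (simp add: ext_quasi_pseudometric_three_point_dist)
  show "preserves_triangle_triplets I F"
    unfolding preserves_triangle_triplets_def
  proof (intro conjI ballI impI)
    \<comment> \<open>The value at the origin is an aggregated self-distance; the zero triplet is
      merely an admissible choice.\<close>
    have "F (\<lambda>i\<in>I. three_point_dist p q r 0 0 0 p p) = 0"
      using key[of "\<lambda>_. 0" "\<lambda>_. 0" "\<lambda>_. 0"] unfolding ext_quasi_pseudometric_def by auto
    then show "F (\<lambda>i\<in>I. 0) = 0"
      by (simp add: three_point_dist_def)
  next
    fix a b c :: "'i \<Rightarrow> ennreal"
    assume abc: "a \<in> I \<rightarrow>\<^sub>E UNIV" "b \<in> I \<rightarrow>\<^sub>E UNIV" "c \<in> I \<rightarrow>\<^sub>E UNIV"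
    assume "\<forall>i\<in>I. a i \<le> b i + c i"
    from key[OF this] have "F (\<lambda>i\<in>I. three_point_dist p q r (a i) (b i) (c i) p q)
        \<le> F (\<lambda>i\<in>I. three_point_dist p q r (a i) (b i) (c i) p r)
          + F (\<lambda>i\<in>I. three_point_dist p q r (a i) (b i) (c i) r q)"
      unfolding ext_quasi_pseudometric_def by blast
    then have "F (restrict a I) \<le> F (restrict b I) + F (restrict c I)"
      using pqr by (simp add: three_point_dist_def)
    with abc show "F a \<le> F b + F c"
      by (simp add: PiE_restrict)
  qed
qed

lemma eqpm_aggregation_on_products_iff:
  fixes I :: "'i set"
  shows "eqpm_aggregation_on_products TYPE('x::infinite) I F \<longleftrightarrow> preserves_triangle_triplets I F"
proof
  assume F: "preserves_triangle_triplets I F"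
  show "eqpm_aggregation_on_products TYPE('x) I F"
    unfolding eqpm_aggregation_on_products_def
  proof (intro allI impI)
    fix X :: "'i \<Rightarrow> 'x set" and d
    assume d: "\<forall>i\<in>I. ext_quasi_pseudometric (X i) (d i)"
    \<comment> \<open>By the axiom of choice, since every factor is nonempty.\<close>
    then have "Pi\<^sub>E I X \<noteq> {}"
      by (auto simp: PiE_eq_empty_iff ext_quasi_pseudometric_def)
    moreover have "F (\<lambda>i\<in>I. d i (x i) (x i)) = 0" if "x \<in> Pi\<^sub>E I X" for x
    proof -
      have "(\<lambda>i\<in>I. d i (x i) (x i)) = (\<lambda>i\<in>I. 0)"
        using d that by (auto simp: ext_quasi_pseudometric_def PiE_mem)
      then show ?thesis using F by (simp add: preserves_triangle_triplets_def)
    qed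
    moreover have "F (\<lambda>i\<in>I. d i (x i) (y i)) \<le> F (\<lambda>i\<in>I. d i (x i) (z i)) + F (\<lambda>i\<in>I. d i (z i) (y i))"
      if "x \<in> Pi\<^sub>E I X" "y \<in> Pi\<^sub>E I X" "z \<in> Pi\<^sub>E I X" for x y z
      using d that
      by (intro preserves_triangle_tripletsD[OF F]) (simp add: ext_quasi_pseudometric_def PiE_mem)
    ultimately show "ext_quasi_pseudometric (Pi\<^sub>E I X) (\<lambda>x y. F (\<lambda>i\<in>I. d i (x i) (y i)))"
      by (simp add: ext_quasi_pseudometric_def)
  qed
next
  assume F: "eqpm_aggregation_on_products TYPE('x) I F"
  have "eqpm_aggregation_on_sets TYPE('x) I F"
    unfolding eqpm_aggregation_on_sets_def
  proof (intro allI impI)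
    fix X :: "'x set" and d
    assume "X \<noteq> {}" and d: "\<forall>i\<in>I. ext_quasi_pseudometric X (d i)"
    \<comment> \<open>The diagonal embedding of \<open>X\<close> into its \<open>I\<close>-fold
      power: the aggregated distance on \<open>X\<close> is the pullback of the one on the power,
      and pullbacks to a nonempty set keep the axioms.\<close>
    define \<delta> where "\<delta> x = (\<lambda>i\<in>I. x)" for x :: 'x
    have \<delta>: "\<delta> x \<in> I \<rightarrow>\<^sub>E X" if "x \<in> X" for x
      using that by (simp add: \<delta>_def)
    have eq: "(\<lambda>i\<in>I. d i x y) = (\<lambda>i\<in>I. d i (\<delta> x i) (\<delta> y i))" for x y
      by (auto simp: \<delta>_def)
    have "ext_quasi_pseudometric (I \<rightarrow>\<^sub>E X) (\<lambda>x y. F (\<lambda>i\<in>I. d i (x i) (y i)))"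
      using F d by (simp add: eqpm_aggregation_on_products_def)
    with \<open>X \<noteq> {}\<close> \<delta> show "ext_quasi_pseudometric X (\<lambda>x y. F (\<lambda>i\<in>I. d i x y))"
      unfolding eq ext_quasi_pseudometric_def by blast
  qed
  then show "preserves_triangle_triplets I F"
    by (simp add: eqpm_aggregation_on_sets_iff)
qed

text \<open>The order of \<open>P\<^sub>+\<close> is reversed, so the unit axiom reads
  \<open>a x x \<le> 0\<close>, which forces the value 0, and the composition axiom becomes the
  triangle inequality.\<close>

lemma V_category_lawvere_iff: "V_category P\<^sub>+ X a \<longleftrightarrow> ext_quasi_pseudometric X a"
  by (simp add: V_category_def ext_quasi_pseudometric_def lawvere_quantale_def)

text \<open>Order and tensor are componentwise, so the axioms split over \<open>I\<close>.
  Nonemptiness of \<open>X\<close> stands apart because for empty \<open>I\<close> the family says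
  nothing about \<open>X\<close>.\<close>

lemma V_category_lawvere_power_iff:
  "V_category (lawvere_power I) X a \<longleftrightarrow>
    X \<noteq> {} \<and> (\<forall>x\<in>X. \<forall>y\<in>X. a x y \<in> I \<rightarrow>\<^sub>E UNIV) \<and>
    (\<forall>i\<in>I. ext_quasi_pseudometric X (\<lambda>x y. a x y i))"
  by (auto simp: V_category_def ext_quasi_pseudometric_def lawvere_power_def)

lemma preserving_iff_eqpm_aggregation_on_sets:
  "preserving TYPE('x) (lawvere_power I) P\<^sub>+ F \<longleftrightarrow> eqpm_aggregation_on_sets TYPE('x) I F"
proof
  assume F: "preserving TYPE('x) (lawvere_power I) P\<^sub>+ F"
  show "eqpm_aggregation_on_sets TYPE('x) I F"
    unfolding eqpm_aggregation_on_sets_def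
  proof (intro allI impI)
    fix X :: "'x set" and d
    assume "X \<noteq> {}" "\<forall>i\<in>I. ext_quasi_pseudometric X (d i)"
    then have "V_category (lawvere_power I) X (\<lambda>x y. \<lambda>i\<in>I. d i x y)"
      by (simp add: V_category_lawvere_power_iff)
    with F show "ext_quasi_pseudometric X (\<lambda>x y. F (\<lambda>i\<in>I. d i x y))"
      unfolding preserving_def V_category_lawvere_iff by blast
  qed
next
  assume F: "eqpm_aggregation_on_sets TYPE('x) I F"
  have "ext_quasi_pseudometric X (\<lambda>x y. F (a x y))"
    if "V_category (lawvere_power I) X a" for X :: "'x set" and a
  proof -
    have a: "X \<noteq> {}" "\<forall>x\<in>X. \<forall>y\<in>X. a x y \<in> I \<rightarrow>\<^sub>E UNIV"
      "\<forall>i\<in>I. ext_quasi_pseudometric X (\<lambda>x y. a x y i)"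
      using that by (simp_all add: V_category_lawvere_power_iff)
    have "ext_quasi_pseudometric X (\<lambda>x y. F (restrict (a x y) I))"
      using F[unfolded eqpm_aggregation_on_sets_def, rule_format,
          of X "\<lambda>i x y. a x y i"] a(1,3) by blast
    \<comment> \<open>Aggregation evaluates \<open>F\<close> at restricted families; the values of
      \<open>a\<close> on \<open>X\<close> are already extensional, so this is the composite of
      \<open>F\<close> with \<open>a\<close>.\<close>
    moreover have "restrict (a x y) I = a x y" if "x \<in> X" "y \<in> X" for x y
      using a(2) that by (intro PiE_restrict) blast
    ultimately show ?thesis
      by (simp add: ext_quasi_pseudometric_def)
  qed
  then show "preserving TYPE('x) (lawvere_power I) P\<^sub>+ F"
    by (simp add: preserving_def V_category_lawvere_iff) (simp add: lawvere_quantale_def)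
qed

theorem lemma3p7:
  fixes I :: "'i set"
  shows
    "(\<forall>F \<in> carrier (lawvere_power I) \<rightarrow> carrier P\<^sub>+.
        (preserving TYPE('x::infinite) (lawvere_power I) P\<^sub>+ F \<longleftrightarrow>
          eqpm_aggregation_on_products TYPE('y::infinite) I F) \<and>
        (eqpm_aggregation_on_products TYPE('y) I F \<longleftrightarrow>
          eqpm_aggregation_on_sets TYPE('z::infinite) I F)) \<and>
     preserving_functions TYPE('x) (lawvere_power I) P\<^sub>+ = EQPMAP TYPE('y) I \<and>
     EQPMAP TYPE('y) I = EQPMAS TYPE('z) I"
proof -
  have "carrier (lawvere_power I) = I \<rightarrow>\<^sub>E UNIV" "carrier P\<^sub>+ = UNIV"
    by (simp_all add: lawvere_power_def lawvere_quantale_def)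
  \<comment> \<open>All three notions rewrite to \<open>preserves_triangle_triplets I F\<close>,
    which mentions no universe of points; hence the three universes may be different types. The
    carriers computed above identify the function spaces underlying the three families.\<close>
  then show ?thesis
    by (simp add: preserving_functions_def EQPMAP_def EQPMAS_def
        preserving_iff_eqpm_aggregation_on_sets eqpm_aggregation_on_sets_iff
        eqpm_aggregation_on_products_iff)
qed

end
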